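(* Let $0<q<1$. For nonzero complex $a,b,c,d$ (as an identity of meromorphic functions in $(a,b,c,d)$), $$\theta\Bigl(a^2,b^2c^2,-b^2,qb^2d^2,-\frac{qb^2}{acd},-qb^2;q^2\Bigr)-\theta\Bigl(b^4,-\frac{qc}{ad},acd,-\frac{ac}{d},qacd,-\frac{qa}{b^2cd};q^2\Bigr)$$ $$=\frac{\theta\bigl(-qab^2cd;q^2\bigr)\,\theta\bigl(-b^2;q\bigr)}{\theta\bigl(qa^2;q^2\bigr)\,\theta\bigl(-q^{\frac{1}{2}}abc;q\bigr)}\left\{\theta\Bigl(bc,-bc,a^2,q^{\frac{1}{2}}bd,-\frac{q^{\frac{1}{2}}b}{ac},-\frac{q^{\frac{1}{2}}d}{b};q\Bigr)-\theta\Bigl(b^2,-q^{\frac{1}{2}}a,acd,-\frac{ac}{d},q^{\frac{1}{2}}a,-\frac{q^{\frac{1}{2}}a}{bc};q\Bigr)\right\}.$$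
   Context: For $0<p<1$ and $u\in\mathbb{C}^*$: $(u;p)_\infty=\prod_{i\geq 0}(1-up^i)$, $\theta(u;p)=(u;p)_\infty(p/u;p)_\infty$ (modified Jacobi theta function), and $\theta(u_1,\ldots,u_r;p)=\prod_{i=1}^r\theta(u_i;p)$. $q^{1/2}$ denotes the positive square root. *)

theory Defs
  imports "HOL-Analysis.Analysis"
begin

definition qpoch_inf :: "complex \<Rightarrow> real \<Rightarrow> complex" where
  "qpoch_inf u p = (\<Prod>i. 1 - u * complex_of_real p ^ i)"

text \<open>The modified Jacobi theta function in multiplicative notation, used for
  \<open>0 < p < 1\<close> and \<open>u \<noteq> 0\<close>.\<close>

definition mtheta :: "complex \<Rightarrow> real \<Rightarrow> complex" where
  "mtheta u p = qpoch_inf u p * qpoch_inf (complex_of_real p / u) p"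

definition mthetas :: "complex list \<Rightarrow> real \<Rightarrow> complex" where
  "mthetas us p = (\<Prod>u\<leftarrow>us. mtheta u p)"

end

theory Submission
  imports Defs "HOL-Library.Nat_Bijection"
begin

text \<open>
  After clearing the denominator and cancelling common factors by the two elementary relations between bases,
  \<open>\<theta>(u; q) = \<theta>(u; q\<^sup>2) \<theta>(q u; q\<^sup>2)\<close> and \<open>\<theta>(u\<^sup>2; q\<^sup>2) = \<theta>(u; q) \<theta>(- u; q)\<close>, the identity has four terms. They
  form two pairs, each pair with a large common factor. Inside each pair there remains a difference of
  two products of theta functions with bases \<open>q\<close> and \<open>q\<^sup>2\<close>, and such a difference is a single product:
  lemmas \<open>mtheta_two_base_reflection\<close> and \<open>mtheta_two_base_addition\<close>. The two resulting products are equal.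

  Both lemmas are instances of Weierstrass' three-term addition formula \<open>weierstrass_addition\<close>, one in
  base \<open>q\<close> and one in base \<open>q\<^sup>2\<close>. The addition formula in turn follows from the Jacobi triple product:
  the double series of \<open>\<theta>(x y; p) \<theta>(x / y; p)\<close>, split by the parity of the difference of the summation
  indices, is a sum of two terms that are each a function of \<open>x\<close> times a function of \<open>y\<close>
  (\<open>mtheta_mult_split\<close>), and three-term relations of this kind hold for all \<open>2 \<times> 2\<close> determinants.
  The triple product itself is the limit of its finite form, which rests on the Pascal rules for
  Gaussian binomial coefficients.
\<close>

section \<open>Elementary properties of the theta function\<close>

lemma convergent_prod_qpoch:
  fixes u :: complex
  assumes "0 < p" "p < 1"
  shows "convergent_prod (\<lambda>i. 1 - u * of_real p ^ i)"
proof -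
  have "summable (\<lambda>i. norm u * p ^ i)"
    using assms by (intro summable_mult summable_geometric) auto
  hence "summable (\<lambda>i. norm (1 - u * of_real p ^ i - 1))"
    using assms by (simp add: norm_mult norm_power)
  thus ?thesis
    by (intro abs_convergent_prod_imp_convergent_prod summable_imp_abs_convergent_prod)
qed

lemma qpoch_inf_LIMSEQ:
  assumes "0 < p" "p < 1"
  shows "(\<lambda>n. \<Prod>i<n. 1 - u * of_real p ^ i) \<longlonglongrightarrow> qpoch_inf u p"
  unfolding qpoch_inf_def
  using convergent_prod_LIMSEQ[OF convergent_prod_qpoch[OF assms, of u]]
  by (subst filterlim_sequentially_Suc [symmetric]) (simp add: lessThan_Suc_atMost)

lemma qpoch_inf_rec:
  assumes "0 < p" "p < 1"
  shows "qpoch_inf u p = (1 - u) * qpoch_inf (of_real p * u) p"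
proof -
  have "(\<lambda>n. \<Prod>i<Suc n. 1 - u * of_real p ^ i) \<longlonglongrightarrow> qpoch_inf u p"
    using qpoch_inf_LIMSEQ[OF assms] by (subst filterlim_sequentially_Suc)
  moreover have "(\<lambda>n. (1 - u) * (\<Prod>i<n. 1 - (of_real p * u) * of_real p ^ i))
      \<longlonglongrightarrow> (1 - u) * qpoch_inf (of_real p * u) p"
    by (intro tendsto_mult tendsto_const qpoch_inf_LIMSEQ assms)
  moreover have "(\<Prod>i<Suc n. 1 - u * of_real p ^ i)
      = (1 - u) * (\<Prod>i<n. 1 - (of_real p * u) * of_real p ^ i)" for n
    by (simp add: prod.lessThan_Suc_shift mult_ac del: prod.lessThan_Suc)
  ultimately show ?thesis
    using LIMSEQ_unique by simp
qed

text \<open>The factors with even index form the first product in base \<open>p\<^sup>2\<close>, those with odd index the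
  second.\<close>

lemma qpoch_inf_bisect:
  assumes "0 < p" "p < 1"
  shows "qpoch_inf u p = qpoch_inf u (p\<^sup>2) * qpoch_inf (of_real p * u) (p\<^sup>2)"
proof -
  have p2: "0 < p\<^sup>2" "p\<^sup>2 < 1"
    using assms by (auto simp: power_less_one_iff)
  have split: "(\<Prod>i<2 * n. 1 - u * of_real p ^ i)
      = (\<Prod>i<n. 1 - u * of_real (p\<^sup>2) ^ i) * (\<Prod>i<n. 1 - (of_real p * u) * of_real (p\<^sup>2) ^ i)" for n
    by (induction n) (simp_all add: power_mult [symmetric] mult_ac)
  have "filterlim (\<lambda>n::nat. 2 * n) at_top sequentially"
    by (rule filterlim_subseq) (auto simp: strict_mono_def)
  from filterlim_compose[OF qpoch_inf_LIMSEQ[OF assms, of u] this]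
  have "(\<lambda>n. \<Prod>i<2 * n. 1 - u * of_real p ^ i) \<longlonglongrightarrow> qpoch_inf u p" .
  moreover have "(\<lambda>n. (\<Prod>i<n. 1 - u * of_real (p\<^sup>2) ^ i)
      * (\<Prod>i<n. 1 - (of_real p * u) * of_real (p\<^sup>2) ^ i))
      \<longlonglongrightarrow> qpoch_inf u (p\<^sup>2) * qpoch_inf (of_real p * u) (p\<^sup>2)"
    by (intro tendsto_mult qpoch_inf_LIMSEQ p2)
  ultimately show ?thesis
    unfolding split by (rule LIMSEQ_unique)
qed

text \<open>Each factor on the left is a difference of squares.\<close>

lemma qpoch_inf_square:
  assumes "0 < p" "p < 1"
  shows "qpoch_inf (u\<^sup>2) (p\<^sup>2) = qpoch_inf u p * qpoch_inf (- u) p"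
  unfolding qpoch_inf_def prodinf_mult[OF convergent_prod_qpoch[OF assms]
      convergent_prod_qpoch[OF assms]]
  by (simp add: algebra_simps power2_eq_square power_mult_distrib)

lemma mtheta_inversion:
  assumes "0 < p"
  shows "mtheta (of_real p / u) p = mtheta u p"
  using assms by (simp add: mtheta_def)

text \<open>Replacing \<open>u\<close> by \<open>p u\<close> moves the factor \<open>1 - u\<close> out of one product and \<open>1 - 1 / u\<close> into the
  other, and \<open>1 - 1 / u = - (1 - u) / u\<close>.\<close>

lemma mtheta_shift:
  assumes "0 < p" "p < 1" "u \<noteq> 0"
  shows "mtheta (of_real p * u) p = - mtheta u p / u"
proof -
  have "mtheta (of_real p * u) p = qpoch_inf (of_real p * u) p * qpoch_inf (1 / u) p"
    using assms by (simp add: mtheta_def)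
  also have "qpoch_inf (1 / u) p = (1 - 1 / u) * qpoch_inf (of_real p / u) p"
    using qpoch_inf_rec[OF assms(1,2), of "1 / u"] by simp
  also have "qpoch_inf (of_real p * u) p * ((1 - 1 / u) * qpoch_inf (of_real p / u) p)
      = - ((1 - u) * qpoch_inf (of_real p * u) p * qpoch_inf (of_real p / u) p) / u"
    using assms(3) by (simp add: diff_divide_distrib algebra_simps)
  also have "(1 - u) * qpoch_inf (of_real p * u) p = qpoch_inf u p"
    by (rule qpoch_inf_rec[OF assms(1,2), symmetric])
  finally show ?thesis
    by (simp add: mtheta_def)
qed

lemma mtheta_bisect:
  assumes "0 < p" "p < 1" "u \<noteq> 0"
  shows "mtheta u p = mtheta u (p\<^sup>2) * mtheta (of_real p * u) (p\<^sup>2)"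
  using assms qpoch_inf_bisect[OF assms(1,2), of u] qpoch_inf_bisect[OF assms(1,2), of "of_real p / u"]
  by (simp add: mtheta_def power2_eq_square)

lemma mtheta_square:
  assumes "0 < p" "p < 1" "u \<noteq> 0"
  shows "mtheta (u\<^sup>2) (p\<^sup>2) = mtheta u p * mtheta (- u) p"
  using assms qpoch_inf_square[OF assms(1,2), of u] qpoch_inf_square[OF assms(1,2), of "of_real p / u"]
  by (simp add: mtheta_def power_divide)

section \<open>The Jacobi triple product\<close>

text \<open>The exponent is \<open>k (k - 1) / 2\<close>; a real power makes it additive in the exponent without any
  parity argument, for negative \<open>k\<close> too.\<close>

definition theta_term :: "real \<Rightarrow> complex \<Rightarrow> int \<Rightarrow> complex" where
  "theta_term p u k = of_real (p powr (of_int (k * (k - 1)) / 2)) * (- u) powi k"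

lemma theta_term_step:
  assumes "0 < p" "u \<noteq> 0"
  shows "theta_term p u (k + 1) = - u * of_real (p powr of_int k) * theta_term p u k"
proof -
  have *: "of_int ((k + 1) * (k + 1 - 1)) / 2 = of_int k + of_int (k * (k - 1)) / (2::real)"
    by (simp add: field_simps)
  show ?thesis
    unfolding theta_term_def * powr_add using assms by (simp add: power_int_add)
qed

text \<open>Negative indices of the bilateral series are nonnegative indices of the series at \<open>p / u\<close>, so
  that only a one-sided series has to be estimated.\<close>

lemma theta_term_uminus:
  assumes "0 < p" "u \<noteq> 0"
  shows "theta_term p u (- k) = theta_term p (of_real p / u) k"
proof -
  have *: "of_int (- k * (- k - 1)) / 2 = of_int (k * (k - 1)) / 2 + real_of_int k"
    by (simp add: field_simps)
  have "theta_term p u (- k) = of_real (p powr (of_int (k * (k - 1)) / 2))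
      * (of_real (p powr of_int k) * (- u) powi (- k))"
    unfolding theta_term_def * by (simp add: powr_add)
  also have "of_real (p powr of_int k) * (- u) powi (- k) = (- (of_real p / u)) powi k"
    using assms powr_real_of_int'[of p k]
    by (simp add: power_int_minus power_int_divide_distrib of_real_power_int field_simps
          flip: divide_minus_right)
  finally show ?thesis
    by (simp add: theta_term_def)
qed

lemma summable_theta_term_nat:
  assumes "0 < p" "p < 1" "u \<noteq> 0"
  shows "summable (\<lambda>n. norm (theta_term p u (int n)))"
proof -
  have "(\<lambda>n. p ^ n * norm u) \<longlonglongrightarrow> 0 * norm u"
    using assms by (intro tendsto_mult LIMSEQ_realpow_zero tendsto_const) auto
  hence "eventually (\<lambda>n. p ^ n * norm u < 1 / 2) sequentially"
    by (rule order_tendstoD) auto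
  then obtain N where N: "\<And>n. n \<ge> N \<Longrightarrow> p ^ n * norm u < 1 / 2"
    by (auto simp: eventually_sequentially)
  show ?thesis
  proof (rule summable_ratio_test)
    show "norm (norm (theta_term p u (int (Suc n)))) \<le> 1 / 2 * norm (norm (theta_term p u (int n)))"
      if "N \<le> n" for n
    proof -
      have "norm (theta_term p u (int n + 1)) = (p ^ n * norm u) * norm (theta_term p u (int n))"
        using assms by (simp add: theta_term_step norm_mult norm_power powr_realpow mult_ac)
      also have "\<dots> \<le> 1 / 2 * norm (theta_term p u (int n))"
        using N[OF that] by (intro mult_right_mono) auto
      finally show ?thesis
        by (simp add: add.commute)
    qed
  qed auto
qed

lemma theta_term_abs_summable:
  assumes "0 < p" "p < 1" "u \<noteq> 0"
  shows "(\<lambda>k. norm (theta_term p u k)) summable_on UNIV"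
proof -
  have nat: "(\<lambda>n. norm (theta_term p v (int n))) summable_on UNIV" if "v \<noteq> 0" for v
    using summable_theta_term_nat[OF assms(1,2) that]
    by (simp add: summable_on_UNIV_nonneg_real_iff)
  have "(\<lambda>k. norm (theta_term p u k)) summable_on range int"
    using nat[OF assms(3)] by (subst summable_on_reindex) (auto simp: o_def)
  moreover have "(\<lambda>k. norm (theta_term p u k)) summable_on range (\<lambda>n. - int n)"
    using nat[of "of_real p / u"] assms
    by (subst summable_on_reindex) (auto simp: o_def inj_on_def theta_term_uminus)
  ultimately have "(\<lambda>k. norm (theta_term p u k)) summable_on (range int \<union> range (\<lambda>n. - int n))"
    by (rule summable_on_union)
  moreover have "k \<in> range int \<union> range (\<lambda>n. - int n)" for k
    by (cases k rule: int_cases2) auto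
  hence "range int \<union> range (\<lambda>n. - int n) = UNIV"
    by blast
  ultimately show ?thesis
    by simp
qed

text \<open>This is \<open>(p; p)\<^sub>n\<close>; the factor is written \<open>p * p ^ i\<close> to match \<open>qpoch_inf\<close> at \<open>u = p\<close>.\<close>

definition qfact :: "real \<Rightarrow> nat \<Rightarrow> real" where
  "qfact p n = (\<Prod>i<n. 1 - p * p ^ i)"

text \<open>The Gaussian binomial coefficient, extended by zero to all integers: sums against it then range
  over all of \<open>\<int>\<close>, and an index shift never changes the range.\<close>

definition qbinomial :: "real \<Rightarrow> nat \<Rightarrow> int \<Rightarrow> real" where
  "qbinomial p n j =
     (if 0 \<le> j \<and> j \<le> int n then qfact p n / (qfact p (nat j) * qfact p (n - nat j)) else 0)"

lemma qfact_pos: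
  assumes "0 < p" "p < 1"
  shows "0 < qfact p n"
  unfolding qfact_def using assms power_Suc_less_one[of p]
  by (intro prod_pos) (simp add: flip: power_Suc)

lemma qbinomial_symmetric: "qbinomial p n (int n - j) = qbinomial p n j"
proof (cases "0 \<le> j \<and> j \<le> int n")
  case True
  define m where "m = nat j"
  have "j = int m" "m \<le> n"
    using True by (auto simp: m_def)
  moreover have "nat (int n - int m) = n - m"
    by simp
  ultimately show ?thesis
    by (simp add: qbinomial_def mult.commute)
qed (auto simp: qbinomial_def)

text \<open>The first of the two Pascal rules: over the common denominator it reduces to
  \<open>1 - x y = (1 - y) + y (1 - x)\<close>, where \<open>1 - x\<close> and \<open>1 - y\<close> are the last factors of the two
  factorials in the denominator.\<close>

lemma qbinomial_Suc:
  assumes "0 < p" "p < 1"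
  shows "qbinomial p (Suc n) j = qbinomial p n j + p powr of_int (int n + 1 - j) * qbinomial p n (j - 1)"
proof -
  have nz: "qfact p m \<noteq> 0" for m
    using qfact_pos[OF assms, of m] by simp
  consider "j < 0 \<or> j > int n + 1" | "j = 0" | "j = int n + 1" | "1 \<le> j" "j \<le> int n"
    by linarith
  thus ?thesis
  proof cases
    case 4
    define m r where "m = nat (j - 1)" and "r = n - nat j"
    have j: "j = int (Suc m)" and n: "n = Suc (m + r)"
      using 4 by (auto simp: m_def r_def)
    have pw: "p powr of_int (int n + 1 - j) = p * p ^ r"
      using assms powr_realpow[of p "Suc r"] by (simp add: j n add_ac)
    have fact: "qfact p (Suc k) = qfact p k * (1 - p * p ^ k)" for k
      by (simp add: qfact_def)
    have ne: "1 - p * p ^ k \<noteq> 0" for k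
      using assms power_Suc_less_one[of p k] by auto
    have pn: "p * p ^ n = (p * p ^ m) * (p * p ^ r)"
      by (simp add: n power_add)
    have qb: "qbinomial p (Suc n) j = qfact p (Suc n) / (qfact p (Suc m) * qfact p (Suc r))"
      "qbinomial p n j = qfact p n / (qfact p (Suc m) * qfact p r)"
      by (simp_all add: qbinomial_def j n Suc_diff_le del: of_nat_Suc)
    have qb': "qbinomial p n (j - 1) = qfact p n / (qfact p m * qfact p (Suc r))"
      by (simp add: qbinomial_def j n Suc_diff_le)
    have alg: "A * (1 - x * y) / (B * (1 - x) * (C * (1 - y)))
        = A / (B * (1 - x) * C) + y * (A / (B * (C * (1 - y))))"
      if "B \<noteq> 0" "C \<noteq> 0" "1 - x \<noteq> 0" "1 - y \<noteq> 0" for A B C x y :: real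
      using that by (simp add: divide_simps) (simp add: algebra_simps)
    show ?thesis
      unfolding qb qb' pw fact pn by (intro alg nz ne)
  qed (use nz assms in \<open>auto simp: qbinomial_def nat_add_distrib\<close>)
qed

text \<open>The symmetry of the coefficients turns one Pascal rule into the other.\<close>

lemma qbinomial_Suc':
  assumes "0 < p" "p < 1"
  shows "qbinomial p (Suc n) j = qbinomial p n (j - 1) + p powr of_int j * qbinomial p n j"
  using qbinomial_Suc[OF assms, of n "int n + 1 - j"]
    qbinomial_symmetric[of p "Suc n" j] qbinomial_symmetric[of p n "j - 1"]
    qbinomial_symmetric[of p n j]
  by (simp add: algebra_simps)

lemma has_sum_int_shift:
  fixes f :: "int \<Rightarrow> complex"
  assumes "(f has_sum S) UNIV"
  shows "((\<lambda>k. f (k + c)) has_sum S) UNIV"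
proof -
  have "bij (\<lambda>k::int. k + c)"
    by (rule bij_plus_right)
  from has_sum_reindex_bij_betw[OF this, of f S] show ?thesis
    using assms by simp
qed

text \<open>Cauchy's finite form of the triple product. A new factor \<open>1 - u p\<^sup>M\<close> adds to the series a copy of itself
  shifted by one index, and the first Pascal rule absorbs it; a new factor \<open>1 - p p\<^sup>N / u\<close> shifts in the
  opposite direction and needs the second rule. Both lengths grow independently for this reason.\<close>

lemma finite_jacobi_triple_product:
  assumes p: "0 < p" "p < 1" and u: "u \<noteq> 0"
  shows "((\<lambda>k. theta_term p u k * of_real (qbinomial p (M + N) (int N + k))) has_sum
     (\<Prod>i<M. 1 - u * of_real p ^ i) * (\<Prod>i<N. 1 - of_real p / u * of_real p ^ i)) UNIV"
proof (induction N)
  case 0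
  show ?case
  proof (induction M)
    case 0
    show ?case
      by (rule has_sum_finite_neutralI[of "{0}"])
        (use p in \<open>auto simp: theta_term_def qbinomial_def qfact_def\<close>)
  next
    case (Suc M)
    have "(\<lambda>k. (theta_term p u k * of_real (qbinomial p (Suc M) k)))
        = (\<lambda>k. theta_term p u k * of_real (qbinomial p M k)
          + - u * of_real p ^ M * (theta_term p u (k + -1) * of_real (qbinomial p M (k + -1))))"
    proof
      fix k
      have "of_real (p powr of_int (int M + 1 - k)) * theta_term p u k
          = of_real (p powr of_int (int M + 1 - k)) * (- u * of_real (p powr of_int (k - 1)) * theta_term p u (k - 1))"
        using theta_term_step[OF p(1) u, of "k - 1"] by simp
      also have "\<dots> = - u * of_real (p powr of_int (int M + 1 - k) * p powr of_int (k - 1)) * theta_term p u (k - 1)"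
        by simp
      also have "p powr of_int (int M + 1 - k) * p powr of_int (k - 1) = p ^ M"
        using p by (simp add: powr_realpow flip: powr_add)
      finally have "of_real (p powr of_int (int M + 1 - k)) * theta_term p u k
          = - u * of_real p ^ M * theta_term p u (k - 1)" by simp
      from arg_cong[OF this, of "\<lambda>z. z * of_real (qbinomial p M (k - 1))"]
      show "theta_term p u k * of_real (qbinomial p (Suc M) k) = theta_term p u k * of_real (qbinomial p M k)
          + - u * of_real p ^ M * (theta_term p u (k + -1) * of_real (qbinomial p M (k + -1)))"
        unfolding qbinomial_Suc[OF p] by (simp add: algebra_simps)
    qed
    moreover have "(\<dots> has_sum (\<Prod>i<M. 1 - u * of_real p ^ i)
        + - u * of_real p ^ M * (\<Prod>i<M. 1 - u * of_real p ^ i)) UNIV"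
      using Suc.IH by (intro has_sum_add has_sum_cmult_right has_sum_int_shift
          [of "\<lambda>k. theta_term p u k * of_real (qbinomial p M k)"]) simp_all
    ultimately show ?case
      by (simp add: algebra_simps)
  qed
next
  case (Suc N)
  define S where "S = (\<Prod>i<M. 1 - u * of_real p ^ i) * (\<Prod>i<N. 1 - of_real p / u * of_real p ^ i)"
  define f where "f = (\<lambda>k. theta_term p u k * of_real (qbinomial p (M + N) (int N + k)))"
  have "(\<lambda>k. theta_term p u k * of_real (qbinomial p (M + Suc N) (int (Suc N) + k)))
      = (\<lambda>k. f k + - (of_real p / u * of_real p ^ N) * f (k + 1))"
  proof
    fix k
    have "of_real p ^ N * of_real p * theta_term p u (k + 1)
        = of_real (p ^ Suc N) * (- u * of_real (p powr of_int k) * theta_term p u k)"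
      unfolding theta_term_step[OF p(1) u] by (simp add: mult_ac)
    also have "\<dots> = - u * of_real (p ^ Suc N * p powr of_int k) * theta_term p u k"
      by simp
    also have "p ^ Suc N * p powr of_int k = p powr of_int (int (Suc N) + k)"
      using p by (simp add: powr_add flip: powr_realpow)
    finally have "of_real (p powr of_int (int (Suc N) + k)) * theta_term p u k
        = - (of_real p / u * of_real p ^ N) * theta_term p u (k + 1)"
      using u by (simp add: field_simps)
    from arg_cong[OF this, of "\<lambda>z. z * of_real (qbinomial p (M + N) (int (Suc N) + k))"]
    show "theta_term p u k * of_real (qbinomial p (M + Suc N) (int (Suc N) + k))
        = f k + - (of_real p / u * of_real p ^ N) * f (k + 1)"
      unfolding f_def add_Suc_right qbinomial_Suc'[OF p] by (simp add: algebra_simps)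
  qed
  moreover have "(\<dots> has_sum S + - (of_real p / u * of_real p ^ N) * S) UNIV"
    using Suc.IH unfolding S_def [symmetric] f_def [symmetric]
    by (intro has_sum_add has_sum_cmult_right has_sum_int_shift)
  ultimately show ?case
    by (simp add: S_def algebra_simps)
qed

text \<open>The positive lower bound \<open>L\<close> bounds all Gaussian binomial coefficients by \<open>1 / L\<^sup>2\<close>, which
  dominates the passage to the limit below.\<close>

lemma qfact_limit:
  assumes "0 < p" "p < 1"
  obtains L where "0 < L" "qfact p \<longlonglongrightarrow> L" "\<And>n. L \<le> qfact p n" "qpoch_inf (of_real p) p = of_real L"
proof -
  define L where "L = Re (qpoch_inf (of_real p) p)"
  have lim: "(\<lambda>n. of_real (qfact p n)) \<longlonglongrightarrow> qpoch_inf (of_real p) p"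
    using qpoch_inf_LIMSEQ[OF assms, of "of_real p"] by (simp add: qfact_def)
  have 1: "qfact p \<longlonglongrightarrow> L"
    using tendsto_Re[OF lim] by (simp add: L_def)
  have 2: "qpoch_inf (of_real p) p = of_real L"
    using lim tendsto_of_real[OF 1] by (rule LIMSEQ_unique)
  have "1 - p * p ^ i \<noteq> 0" for i
    using assms power_Suc_less_one[of p i] by auto
  hence "1 - of_real p * of_real p ^ i \<noteq> (0::complex)" for i
    by (metis of_real_1 of_real_diff of_real_eq_0_iff of_real_mult of_real_power)
  hence "qpoch_inf (of_real p) p \<noteq> 0"
    unfolding qpoch_inf_def by (intro prodinf_nonzero convergent_prod_qpoch assms)
  hence "L \<noteq> 0"
    using 2 by auto
  moreover have "0 \<le> L"
    using 1 qfact_pos[OF assms] by (intro LIMSEQ_le_const[OF 1]) (auto intro: less_imp_le)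
  moreover have "decseq (qfact p)"
  proof (rule decseq_SucI)
    fix n
    have "qfact p n * (1 - p * p ^ n) \<le> qfact p n * 1"
      using assms qfact_pos[OF assms, of n] by (intro mult_left_mono) auto
    thus "qfact p (Suc n) \<le> qfact p n"
      by (simp add: qfact_def)
  qed
  hence "L \<le> qfact p n" for n
    using 1 by (rule decseq_ge)
  ultimately show ?thesis
    using 1 2 that[of L] by simp
qed

text \<open>In the finite form with both lengths equal to \<open>N\<close>, each coefficient tends to \<open>1 / (p; p)\<^sub>\<infinity>\<close>, and
  Tannery's theorem exchanges this limit with the sum. The sum over \<open>\<int>\<close> is enumerated along
  \<open>int_decode\<close> because that theorem concerns sums over \<open>\<nat>\<close>.\<close>

theorem jacobi_triple_product:
  assumes p: "0 < p" "p < 1" and u: "u \<noteq> 0"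
  shows "(theta_term p u has_sum qpoch_inf (of_real p) p * mtheta u p) UNIV"
proof -
  obtain L where L: "0 < L" "qfact p \<longlonglongrightarrow> L" "\<And>n. L \<le> qfact p n" "qpoch_inf (of_real p) p = of_real L"
    using qfact_limit[OF p] by metis
  define t where "t = (\<lambda>i. theta_term p u (int_decode i))"
  define g where "g = (\<lambda>i N. t i * of_real (qbinomial p (N + N) (int N + int_decode i)))"
  define P where "P = (\<lambda>N. (\<Prod>i<N. 1 - u * of_real p ^ i) * (\<Prod>i<N. 1 - of_real p / u * of_real p ^ i))"
  have sum_g: "suminf (\<lambda>i. g i N) = P N" for N
    using finite_jacobi_triple_product[OF p u, of N N]
      has_sum_reindex_bij_betw[OF bij_int_decode, of "\<lambda>k. theta_term p u k * of_real (qbinomial p (N + N) (int N + k))" "P N"]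
    by (intro sums_unique [symmetric] has_sum_imp_sums) (simp add: P_def g_def t_def)
  have "(\<lambda>k. norm (theta_term p u k)) summable_on UNIV"
    by (rule theta_term_abs_summable[OF p u])
  hence summable_t: "summable (\<lambda>i. norm (t i))"
    using summable_on_reindex_bij_betw[OF bij_int_decode, of "\<lambda>k. norm (theta_term p u k)"]
    by (simp add: t_def summable_on_UNIV_nonneg_real_iff)
  have lim: "g i \<longlonglongrightarrow> t i * of_real (1 / L)" for i
  proof -
    define k where "k = int_decode i"
    have ev: "eventually (\<lambda>N. qfact p (N + N) / (qfact p (nat (int N + k)) * qfact p (nat (int N - k)))
        = qbinomial p (N + N) (int N + k)) sequentially"
      using eventually_ge_at_top[of "nat \<bar>k\<bar>"]
    proof eventually_elim
      case (elim N)
      have "N + N - nat (int N + k) = nat (int N - k)"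
        using elim by linarith
      moreover have "0 \<le> int N + k" "k \<le> int N"
        using elim by linarith+
      ultimately show ?case
        by (simp add: qbinomial_def)
    qed
    have shift: "filterlim (\<lambda>N. nat (int N + c)) sequentially sequentially" for c
    proof (rule filterlim_at_top_mono[OF filterlim_minus_const_nat_at_top[of "nat \<bar>c\<bar>"]])
      show "eventually (\<lambda>N. N - nat \<bar>c\<bar> \<le> nat (int N + c)) sequentially"
        by (intro always_eventually allI) linarith
    qed
    have *: "filterlim (\<lambda>N. nat (int N + k)) sequentially sequentially"
      "filterlim (\<lambda>N. nat (int N - k)) sequentially sequentially"
      using shift[of k] shift[of "- k"] by simp_all
    have **: "filterlim (\<lambda>N. N + N) sequentially sequentially"
      by (rule filterlim_subseq) (auto simp: strict_mono_def)
    have "(\<lambda>N. qfact p (N + N) / (qfact p (nat (int N + k)) * qfact p (nat (int N - k))))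
        \<longlonglongrightarrow> L / (L * L)"
      using L(1) by (intro tendsto_intros filterlim_compose[OF L(2)] * **) auto
    from Lim_transform_eventually[OF this ev]
    have "(\<lambda>N. qbinomial p (N + N) (int N + k)) \<longlonglongrightarrow> 1 / L"
      using L(1) by simp
    thus ?thesis
      unfolding g_def k_def by (intro tendsto_mult tendsto_const tendsto_of_real)
  qed
  have bound: "norm (g i N) \<le> norm (t i) * (1 / (L * L))" for i N
  proof -
    have "qfact p n \<le> 1" for n
      unfolding qfact_def using p by (intro prod_le_1) (auto simp: mult_le_one power_le_one)
    hence "qfact p n / (qfact p m * qfact p r) \<le> 1 / (L * L)" for n m r
      using L(1,3) by (intro frac_le mult_mono) (auto intro: less_imp_le[OF qfact_pos[OF p]])
    moreover have "0 \<le> qfact p n / (qfact p m * qfact p r)" for n m r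
      using qfact_pos[OF p] by (simp add: less_imp_le)
    ultimately have "\<bar>qbinomial p n j\<bar> \<le> 1 / (L * L)" for n j
      using L(1) by (simp add: qbinomial_def)
    thus ?thesis
      unfolding g_def norm_mult norm_of_real by (intro mult_left_mono) auto
  qed
  have "(\<lambda>N. suminf (\<lambda>i. g i N)) \<longlonglongrightarrow> suminf (\<lambda>i. t i * of_real (1 / L))"
    by (rule conjunct2[OF conjunct2[OF tannerys_theorem[where M = "\<lambda>i. norm (t i) * (1 / (L * L))"]]])
      (use lim bound summable_t in \<open>auto intro!: always_eventually summable_mult2 simp del: of_real_divide\<close>)
  moreover have "P \<longlonglongrightarrow> mtheta u p"
    unfolding P_def mtheta_def by (intro tendsto_mult qpoch_inf_LIMSEQ p)
  ultimately have "suminf (\<lambda>i. t i * of_real (1 / L)) = mtheta u p"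
    unfolding sum_g by (rule LIMSEQ_unique)
  moreover have "suminf (\<lambda>i. t i * of_real (1 / L)) = suminf t * of_real (1 / L)"
    using summable_norm_cancel[OF summable_t] by (rule suminf_mult2 [symmetric])
  ultimately have "suminf t = of_real L * mtheta u p"
    using L(1) by (simp add: field_simps)
  hence "(t has_sum of_real L * mtheta u p) UNIV"
    using norm_summable_imp_has_sum[OF summable_t]
      summable_sums[OF summable_norm_cancel[OF summable_t]] by simp
  thus ?thesis
    using has_sum_reindex_bij_betw[OF bij_int_decode, of "theta_term p u"] by (simp add: t_def L(4))
qed

section \<open>The addition formula of Weierstrass\<close>

lemma theta_term_scale:
  assumes "0 < q" "u \<noteq> 0"
  shows "theta_term p (of_real q * u) k = of_real (q powr of_int k) * theta_term p u k"
proof -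
  have "(- (of_real q * u)) powi k = (of_real q * (- u)) powi k"
    by simp
  also have "\<dots> = of_real (q powr of_int k) * (- u) powi k"
    using assms powr_real_of_int'[of q k]
    by (simp only: power_int_mult_distrib of_real_power_int less_imp_le) simp
  finally show ?thesis
    by (simp add: theta_term_def)
qed

text \<open>The exponents separate because \<open>(k + j)\<^sup>2 + (k - j)\<^sup>2 = 2 k\<^sup>2 + 2 j\<^sup>2\<close>.\<close>

lemma theta_term_mult_even:
  assumes p: "0 < p" and xy: "x \<noteq> 0" "y \<noteq> 0"
  shows "theta_term p (x * y) (k + j) * theta_term p (x / y) (k - j)
    = theta_term (p\<^sup>2) (- (x\<^sup>2)) k * theta_term (p\<^sup>2) (- (of_real p * y\<^sup>2)) j"
proof -
  have "of_int ((k + j) * (k + j - 1)) / 2 + of_int ((k - j) * (k - j - 1)) / 2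
      = real_of_int (k * (k - 1)) + of_int (j * (j - 1)) + of_int j"
    by (simp add: field_simps)
  hence 1: "p powr (of_int ((k + j) * (k + j - 1)) / 2) * p powr (of_int ((k - j) * (k - j - 1)) / 2)
      = p powr of_int (k * (k - 1)) * p powr of_int (j * (j - 1)) * p powr of_int j"
    by (simp only: powr_add [symmetric])
  have 2: "(p\<^sup>2) powr (of_int n / 2) = p powr of_int n" for n
  proof -
    have "(p\<^sup>2) powr (of_int n / 2) = (p powr 2) powr (of_int n / 2)"
      using p by simp
    also have "\<dots> = p powr of_int n"
      unfolding powr_powr by simp
    finally show ?thesis .
  qed
  have 3: "(- (x * y)) powi (k + j) * (- (x / y)) powi (k - j) = (x\<^sup>2) powi k * (y\<^sup>2) powi j"
  proof -
    have "s powi (k + j) * t powi (k - j) = (s * t) powi k * (s / t) powi j"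
      if "s \<noteq> 0" "t \<noteq> 0" for s t :: complex
      using that by (simp add: power_int_add power_int_diff power_int_mult_distrib
          power_int_divide_distrib)
    hence "(- (x * y)) powi (k + j) * (- (x / y)) powi (k - j)
        = ((- (x * y)) * (- (x / y))) powi k * ((- (x * y)) / (- (x / y))) powi j"
      using xy by simp
    moreover have "(- (x * y)) * (- (x / y)) = x\<^sup>2" "(- (x * y)) / (- (x / y)) = y\<^sup>2"
      using xy by (simp_all add: power2_eq_square)
    ultimately show ?thesis by simp
  qed
  have 4: "theta_term (p\<^sup>2) (- (of_real p * y\<^sup>2)) j = of_real (p powr of_int j) * theta_term (p\<^sup>2) (- (y\<^sup>2)) j"
    using theta_term_scale[OF p, of "- (y\<^sup>2)" "p\<^sup>2" j] xy by simp
  have "theta_term p (x * y) (k + j) * theta_term p (x / y) (k - j)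
      = of_real (p powr (of_int ((k + j) * (k + j - 1)) / 2) * p powr (of_int ((k - j) * (k - j - 1)) / 2))
        * ((- (x * y)) powi (k + j) * (- (x / y)) powi (k - j))"
    by (simp add: theta_term_def mult_ac)
  also have "\<dots> = theta_term (p\<^sup>2) (- (x\<^sup>2)) k * theta_term (p\<^sup>2) (- (of_real p * y\<^sup>2)) j"
    unfolding 1 3 4 unfolding theta_term_def 2 by (simp add: mult_ac)
  finally show ?thesis .
qed

lemma theta_term_mult_odd:
  assumes p: "0 < p" and xy: "x \<noteq> 0" "y \<noteq> 0"
  shows "theta_term p (x * y) (k + j) * theta_term p (x / y) (k - j + 1)
    = - (x / y) * (theta_term (p\<^sup>2) (- (of_real p * x\<^sup>2)) k * theta_term (p\<^sup>2) (- (y\<^sup>2)) j)"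
proof -
  have sc: "theta_term (p\<^sup>2) (- (of_real p * z\<^sup>2)) i = of_real (p powr of_int i) * theta_term (p\<^sup>2) (- (z\<^sup>2)) i"
    if "z \<noteq> 0" for z i
    using theta_term_scale[OF p, of "- (z\<^sup>2)" "p\<^sup>2" i] that by simp
  have "theta_term p (x * y) (k + j) * theta_term p (x / y) (k - j + 1)
      = - (x / y) * of_real (p powr of_int (k - j)) * (theta_term p (x * y) (k + j) * theta_term p (x / y) (k - j))"
    using theta_term_step[OF p, of "x / y" "k - j"] xy by (simp add: mult_ac)
  also have "\<dots> = - (x / y) * of_real (p powr of_int (k - j) * p powr of_int j)
      * (theta_term (p\<^sup>2) (- (x\<^sup>2)) k * theta_term (p\<^sup>2) (- (y\<^sup>2)) j)"
    unfolding theta_term_mult_even[OF assms] sc[OF xy(2)] by (simp add: mult_ac)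
  also have "p powr of_int (k - j) * p powr of_int j = p powr of_int k"
    by (simp flip: powr_add)
  finally show ?thesis
    unfolding sc[OF xy(1)] by (simp add: mult_ac)
qed

lemma has_sum_mult_pairs:
  fixes f g :: "'a \<Rightarrow> complex"
  assumes f: "(f has_sum a) UNIV" "(\<lambda>k. norm (f k)) summable_on UNIV"
    and g: "(g has_sum b) UNIV" "(\<lambda>k. norm (g k)) summable_on UNIV"
  shows "((\<lambda>(m, n). f m * g n) has_sum a * b) UNIV"
proof -
  have "((\<lambda>(m, n). f m * g n) has_sum a * b) (UNIV \<times> UNIV)"
  proof (rule has_sum_SigmaI)
    show "((\<lambda>n. case (m, n) of (m, n) \<Rightarrow> f m * g n) has_sum f m * b) UNIV" for m
      using g(1) by (auto intro: has_sum_cmult_right)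
    show "((\<lambda>m. f m * b) has_sum a * b) UNIV"
      using f(1) by (rule has_sum_cmult_left)
    have "(\<lambda>z. norm (case z of (m, n) \<Rightarrow> f m * g n)) summable_on (UNIV \<times> UNIV)"
    proof (rule iffD2[OF Infinite_Sum.abs_summable_on_Sigma_iff], intro conjI ballI)
      show "(\<lambda>n. norm (case (m, n) of (m, n) \<Rightarrow> f m * g n)) summable_on UNIV" for m
        using g(2) by (simp add: norm_mult summable_on_cmult_right)
      have "(\<lambda>m. norm (f m) * norm (\<Sum>\<^sub>\<infinity>n. norm (g n))) summable_on UNIV"
        using f(2) by (rule summable_on_cmult_left)
      thus "(\<lambda>m. norm (\<Sum>\<^sub>\<infinity>n. norm (case (m, n) of (m, n) \<Rightarrow> f m * g n))) summable_on UNIV"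
        by (simp add: norm_mult infsum_cmult_right' abs_mult)
    qed
    thus "(\<lambda>(m, n). f m * g n) summable_on UNIV \<times> UNIV"
      by (rule abs_summable_summable)
  qed
  thus ?thesis
    by simp
qed

text \<open>Expanding both theta functions on the left gives a sum over all pairs \<open>(m, n)\<close>. Where \<open>m - n\<close> is
  even, \<open>m = k + j\<close> and \<open>n = k - j\<close> with independent integers \<open>k, j\<close>, and the summand splits into
  terms of two series in base \<open>p\<^sup>2\<close>; where it is odd, \<open>m = k + j\<close> and \<open>n = k - j + 1\<close> do the same.\<close>

theorem mtheta_mult_split:
  assumes p: "0 < p" "p < 1" and xy: "x \<noteq> 0" "y \<noteq> 0"
  shows "(qpoch_inf (of_real p) p)\<^sup>2 * (mtheta (x * y) p * mtheta (x / y) p)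
    = (qpoch_inf (of_real (p\<^sup>2)) (p\<^sup>2))\<^sup>2
      * (mtheta (- (x\<^sup>2)) (p\<^sup>2) * mtheta (- (of_real p * y\<^sup>2)) (p\<^sup>2)
         - x / y * (mtheta (- (of_real p * x\<^sup>2)) (p\<^sup>2) * mtheta (- (y\<^sup>2)) (p\<^sup>2)))"
proof -
  define C D where "C = qpoch_inf (of_real p) p" and "D = qpoch_inf (of_real (p\<^sup>2)) (p\<^sup>2)"
  have p2: "0 < p\<^sup>2" "p\<^sup>2 < 1"
    using p by (auto simp: power_less_one_iff)
  have pairs: "((\<lambda>(m, n). theta_term r s m * theta_term r t n)
      has_sum (qpoch_inf (of_real r) r * mtheta s r) * (qpoch_inf (of_real r) r * mtheta t r)) UNIV"
    if "0 < r" "r < 1" "s \<noteq> 0" "t \<noteq> 0" for r s t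
    using that by (intro has_sum_mult_pairs jacobi_triple_product theta_term_abs_summable)
  define F where "F = (\<lambda>(m, n). theta_term p (x * y) m * theta_term p (x / y) n)"
  define h h' :: "int \<times> int \<Rightarrow> int \<times> int"
    where "h = (\<lambda>(k, j). (k + j, k - j))" and "h' = (\<lambda>(k, j). (k + j, k - j + 1))"
  have inj: "inj h" "inj h'"
    by (auto simp: inj_def h_def h'_def)
  have "(F has_sum (D * mtheta (- (x\<^sup>2)) (p\<^sup>2)) * (D * mtheta (- (of_real p * y\<^sup>2)) (p\<^sup>2))) (range h)"
    unfolding has_sum_reindex[OF inj(1)]
    using pairs[OF p2, of "- (x\<^sup>2)" "- (of_real p * y\<^sup>2)"] p xy
    by (simp add: F_def h_def o_def case_prod_unfold theta_term_mult_even D_def)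
  moreover have "(F has_sum - (x / y) * ((D * mtheta (- (of_real p * x\<^sup>2)) (p\<^sup>2)) * (D * mtheta (- (y\<^sup>2)) (p\<^sup>2)))) (range h')"
    unfolding has_sum_reindex[OF inj(2)]
    using has_sum_cmult_right[OF pairs[OF p2, of "- (of_real p * x\<^sup>2)" "- (y\<^sup>2)"], of "- (x / y)"] p xy
    by (simp add: F_def h'_def o_def case_prod_unfold theta_term_mult_odd[OF p(1) xy] D_def
        del: minus_mult_left)
  moreover have "range h \<inter> range h' = {}"
    by (auto simp: h_def h'_def) presburger
  ultimately have "(F has_sum (D * mtheta (- (x\<^sup>2)) (p\<^sup>2)) * (D * mtheta (- (of_real p * y\<^sup>2)) (p\<^sup>2))
      + - (x / y) * ((D * mtheta (- (of_real p * x\<^sup>2)) (p\<^sup>2)) * (D * mtheta (- (y\<^sup>2)) (p\<^sup>2))))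
      (range h \<union> range h')"
    by (rule has_sum_Un_disjoint)
  also have "range h \<union> range h' = UNIV"
  proof -
    have "(m, n) \<in> range h \<union> range h'" for m n
    proof (cases "even (m - n)")
      case True
      hence "m = (m + n) div 2 + (m - n) div 2" "n = (m + n) div 2 - (m - n) div 2"
        by presburger+
      hence "(m, n) = h ((m + n) div 2, (m - n) div 2)"
        by (simp add: h_def)
      thus ?thesis by blast
    next
      case False
      hence "m = (m + n - 1) div 2 + (m - n + 1) div 2" "n = (m + n - 1) div 2 - (m - n + 1) div 2 + 1"
        by presburger+
      hence "(m, n) = h' ((m + n - 1) div 2, (m - n + 1) div 2)"
        by (simp add: h'_def)
      thus ?thesis by blast
    qed
    thus ?thesis by auto
  qed
  finally have "(F has_sum (D * mtheta (- (x\<^sup>2)) (p\<^sup>2)) * (D * mtheta (- (of_real p * y\<^sup>2)) (p\<^sup>2))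
      + - (x / y) * ((D * mtheta (- (of_real p * x\<^sup>2)) (p\<^sup>2)) * (D * mtheta (- (y\<^sup>2)) (p\<^sup>2)))) UNIV" .
  moreover have "(F has_sum (C * mtheta (x * y) p) * (C * mtheta (x / y) p)) UNIV"
    using pairs[OF p, of "x * y" "x / y"] xy by (simp add: F_def C_def)
  ultimately have "(C * mtheta (x * y) p) * (C * mtheta (x / y) p)
      = (D * mtheta (- (x\<^sup>2)) (p\<^sup>2)) * (D * mtheta (- (of_real p * y\<^sup>2)) (p\<^sup>2))
      + - (x / y) * ((D * mtheta (- (of_real p * x\<^sup>2)) (p\<^sup>2)) * (D * mtheta (- (y\<^sup>2)) (p\<^sup>2)))"
    using has_sum_unique by blast
  thus ?thesis
    unfolding C_def [symmetric] D_def [symmetric] by (simp add: power2_eq_square algebra_simps)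
qed

text \<open>By \<open>mtheta_mult_split\<close>, \<open>\<theta>(s t) \<theta>(s / t) / s\<close> is a constant times a \<open>2 \<times> 2\<close> determinant whose columns
  depend on \<open>s\<close> and on \<open>t\<close> alone. The three-term relation is the Pluecker relation between the
  \<open>2 \<times> 2\<close> minors of a \<open>2 \<times> 4\<close> matrix.\<close>

theorem weierstrass_addition:
  assumes p: "0 < p" "p < 1" and nz: "x \<noteq> 0" "y \<noteq> 0" "u \<noteq> 0" "v \<noteq> 0"
  shows "mtheta (x * y) p * mtheta (x / y) p * (mtheta (u * v) p * mtheta (u / v) p)
       - mtheta (x * v) p * mtheta (x / v) p * (mtheta (u * y) p * mtheta (u / y) p)
     = u / y * (mtheta (y * v) p * mtheta (y / v) p * (mtheta (x * u) p * mtheta (x / u) p))"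
proof -
  define C D where "C = qpoch_inf (of_real p) p" and "D = qpoch_inf (of_real (p\<^sup>2)) (p\<^sup>2)"
  define A E where "A = (\<lambda>z. mtheta (- (z\<^sup>2)) (p\<^sup>2))"
    and "E = (\<lambda>z. mtheta (- (of_real p * z\<^sup>2)) (p\<^sup>2))"
  have "C \<noteq> 0"
    using qfact_limit[OF p] unfolding C_def by (metis less_irrefl of_real_eq_0_iff)
  hence \<psi>: "mtheta (s * t) p * mtheta (s / t) p = (D / C)\<^sup>2 * (A s * E t - s / t * (E s * A t))"
    if "s \<noteq> 0" "t \<noteq> 0" for s t
    using mtheta_mult_split[OF p that] by (simp add: A_def E_def C_def D_def field_simps)
  have "(A x * E y - x / y * (E x * A y)) * (A u * E v - u / v * (E u * A v))
      - (A x * E v - x / v * (E x * A v)) * (A u * E y - u / y * (E u * A y))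
      = u / y * ((A y * E v - y / v * (E y * A v)) * (A x * E u - x / u * (E x * A u)))"
    using nz by (simp add: field_simps)
  from arg_cong[OF this, of "\<lambda>z. (D / C)\<^sup>2 * (D / C)\<^sup>2 * z"] show ?thesis
    unfolding \<psi>[OF nz(1,2)] \<psi>[OF nz(3,4)] \<psi>[OF nz(1,4)] \<psi>[OF nz(3,2)] \<psi>[OF nz(2,4)] \<psi>[OF nz(1,3)]
    by (simp only: right_diff_distrib mult_ac)
qed

section \<open>Addition formulas that mix the bases \<open>q\<close> and \<open>q\<^sup>2\<close>\<close>

text \<open>Weierstrass' relation in symmetric form. Its four arguments \<open>x, y, u, v\<close> are determined, up to signs, by
  prescribing \<open>x y\<close>, \<open>x / y\<close>, \<open>u v\<close>, \<open>u / v\<close>; under \<open>a1 a2 a3 a4 = 1\<close> all the other products and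
  quotients become rational in the \<open>a\<close>'s and \<open>t\<close>.\<close>

lemma mtheta_quadruple_reflection:
  assumes p: "0 < p" "p < 1" and nz: "t \<noteq> 0" "a1 * a2 * a3 * a4 = 1"
  shows "mtheta (a1 * t) p * mtheta (a2 * t) p * (mtheta (a3 * t) p * mtheta (a4 * t) p)
       - mtheta (t / a1) p * mtheta (t / a2) p * (mtheta (t / a3) p * mtheta (t / a4) p)
     = t / a1 * (mtheta (t\<^sup>2) p * mtheta (a1 * a2) p * (mtheta (a1 * a3) p * mtheta (a1 * a4) p))"
proof -
  have a: "a1 \<noteq> 0" "a2 \<noteq> 0" "a3 \<noteq> 0" "a4 \<noteq> 0"
    using nz(2) by auto
  (* Only x^2 = a1 a2 t^2 is prescribed. The choice u = t^2 / x then fixes the relative sign of the two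
     square roots, and either choice of x works. *)
  define x where "x = csqrt (a1 * a2) * t"
  define y u v where "y = x / (a2 * t)" and "u = t\<^sup>2 / x" and "v = a3 * x / t"
  have x: "x \<noteq> 0" "x * x = a1 * a2 * t * t"
    using a nz(1) power2_csqrt[of "a1 * a2"] by (auto simp: x_def power2_eq_square algebra_simps)
  have yuv: "y \<noteq> 0" "u \<noteq> 0" "v \<noteq> 0"
    using a nz(1) x by (auto simp: y_def u_def v_def)
  have a4: "a4 = 1 / (a1 * a2 * a3)"
    using a nz(2) by (simp add: field_simps)
  have eqs: "x * y = a1 * t" "x / y = a2 * t" "u * v = a3 * t" "u / v = a4 * t"
    "x * v = t / a4" "x / v = t / a3" "u * y = t / a2" "u / y = t / a1"
    "y * v = a1 * a3" "y / v = a1 * a4" "x * u = t\<^sup>2" "x / u = a1 * a2"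
    using a nz(1) x by (auto simp: y_def u_def v_def a4 field_simps power2_eq_square)
  show ?thesis
    using weierstrass_addition[OF p x(1) yuv] unfolding eqs by (simp only: mult_ac)
qed

text \<open>The factors in base \<open>q\<^sup>2\<close> are split by \<open>\<theta>(z\<^sup>2; q\<^sup>2) = \<theta>(z; q) \<theta>(- z; q)\<close>, for which a square root \<open>\<kappa>\<close> of
  \<open>- e d\<close> is needed; then this is the reflection formula in base \<open>q\<close> for the quadruple
  \<open>e, d, 1 / \<kappa>, - 1 / \<kappa>\<close>, whose product is \<open>1\<close>.\<close>

lemma mtheta_two_base_reflection:
  assumes q: "0 < q" "q < 1" and nz: "t \<noteq> 0" "e \<noteq> 0" "d \<noteq> 0"
  shows "mtheta (e * t) q * mtheta (d * t) q * mtheta (- (t\<^sup>2 / (e * d))) (q\<^sup>2)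
       - mtheta (t / e) q * mtheta (t / d) q * mtheta (- (e * d * t\<^sup>2)) (q\<^sup>2)
     = t / e * (mtheta (t\<^sup>2) q * mtheta (e * d) q * mtheta (- (e / d)) (q\<^sup>2))"
proof -
  define \<kappa> where "\<kappa> = csqrt (- (e * d))"
  have \<kappa>: "\<kappa> \<noteq> 0" "\<kappa>\<^sup>2 = - (e * d)"
    using nz by (auto simp: \<kappa>_def)
  have sq: "mtheta w (q\<^sup>2) = mtheta z q * mtheta (- z) q" if "w = z\<^sup>2" "z \<noteq> 0" for w z
    using mtheta_square[OF q that(2)] that(1) by simp
  have 1: "mtheta (- (t\<^sup>2 / (e * d))) (q\<^sup>2) = mtheta (1 / \<kappa> * t) q * mtheta (- 1 / \<kappa> * t) q"
    using \<kappa> nz sq[of "- (t\<^sup>2 / (e * d))" "t / \<kappa>"] by (simp add: power_divide)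
  have 2: "mtheta (- (e * d * t\<^sup>2)) (q\<^sup>2) = mtheta (t / (1 / \<kappa>)) q * mtheta (t / (- 1 / \<kappa>)) q"
    using \<kappa> nz sq[of "- (e * d * t\<^sup>2)" "t * \<kappa>"] by (simp add: power_mult_distrib)
  have 3: "mtheta (- (e / d)) (q\<^sup>2) = mtheta (e * (1 / \<kappa>)) q * mtheta (e * (- 1 / \<kappa>)) q"
    using \<kappa> nz sq[of "- (e / d)" "e / \<kappa>"] by (simp add: power_divide power2_eq_square)
  have prod1: "e * d * (1 / \<kappa>) * (- 1 / \<kappa>) = 1"
    using \<kappa> nz by (simp add: field_simps power2_eq_square)
  show ?thesis
    using mtheta_quadruple_reflection[OF q nz(1) prod1] unfolding 1 2 3 by simp
qed

text \<open>Here everything is moved to base \<open>q\<^sup>2\<close> instead, by \<open>\<theta>(X; q) = \<theta>(X; q\<^sup>2) \<theta>(q X; q\<^sup>2)\<close>. The pair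
  \<open>q X, X\<close> is \<open>x y, x / y\<close> for \<open>x = s X\<close> and \<open>y = s\<close>, where \<open>s\<close> is a square root of \<open>q\<close>; this dictates the
  substitution in Weierstrass' relation.\<close>

lemma mtheta_two_base_addition:
  assumes q: "0 < q" "q < 1" and nz: "X \<noteq> 0" "Y \<noteq> 0" "h \<noteq> 0"
  shows "mtheta X q * (mtheta (Y * h) (q\<^sup>2) * mtheta (of_real q * Y / h) (q\<^sup>2))
       - mtheta Y q * (mtheta (X * h) (q\<^sup>2) * mtheta (of_real q * X / h) (q\<^sup>2))
     = Y * (mtheta h q * (mtheta (of_real q * X * Y) (q\<^sup>2) * mtheta (X / Y) (q\<^sup>2)))"
proof -
  have q2: "0 < q\<^sup>2" "q\<^sup>2 < 1"
    using q by (auto simp: power_less_one_iff)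
  define s where "s = complex_of_real (sqrt q)"
  have s: "s \<noteq> 0" "of_real q = s * s"
    using q by (auto simp: s_def simp flip: of_real_mult)
  have eqs: "(s * X) * s = of_real q * X" "(s * X) / s = X" "(s * Y) * (h / s) = Y * h"
    "(s * Y) / (h / s) = of_real q * Y / h" "(s * X) * (h / s) = X * h"
    "(s * X) / (h / s) = of_real q * X / h" "(s * Y) * s = of_real q * Y" "(s * Y) / s = Y"
    "s * (h / s) = h" "s / (h / s) = of_real q / h" "(s * X) * (s * Y) = of_real q * X * Y"
    "(s * X) / (s * Y) = X / Y"
    using s by (simp_all add: mult_ac)
  have "mtheta (of_real q / h) (q\<^sup>2) = mtheta (of_real q * h) (q\<^sup>2)"
    using mtheta_inversion[OF q2(1), of "of_real q * h"] q nz by (simp add: power2_eq_square)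
  thus ?thesis
    using weierstrass_addition[OF q2, of "s * X" s "s * Y" "h / s"] s nz
    unfolding eqs mtheta_bisect[OF q nz(1)] mtheta_bisect[OF q nz(2)] mtheta_bisect[OF q nz(3)]
    by (simp add: mult_ac)
qed

section \<open>The transformation of sextuple products\<close>

text \<open>Two factors cancel at once: \<open>\<theta>(-b\<^sup>2; q)\<close> divides both terms on the left, because
  \<open>\<theta>(b^4; q\<^sup>2) = \<theta>(b\<^sup>2; q) \<theta>(-b\<^sup>2; q)\<close>, and \<open>\<theta>(q a\<^sup>2; q\<^sup>2)\<close> divides both terms in the braces. What remains is
  \<open>K X = L Y\<close> in the notation of the proof. The terms of \<open>K X - L Y\<close> that come from the first members
  of the differences \<open>X\<close> and \<open>Y\<close> share a factor \<open>U\<close>, those from the second members a factor \<open>V\<close>. The cofactor of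
  \<open>U\<close> is a multiple of \<open>V\<close> (\<open>B1\<close>), the cofactor of \<open>V\<close> is the same multiple of \<open>U\<close> (\<open>B2\<close>), and the
  two contributions cancel.\<close>

theorem corollary7p4:
  fixes q :: real and a b c d :: complex
  assumes "0 < q" and "q < 1"
    and "a \<noteq> 0" and "b \<noteq> 0" and "c \<noteq> 0" and "d \<noteq> 0"
    and "mtheta (q * a^2) (q^2) \<noteq> 0"
    and "mtheta (- (sqrt q * a * b * c)) q \<noteq> 0"
  shows
    "mthetas [a^2, b^2 * c^2, - (b^2), q * b^2 * d^2, - (q * b^2 / (a * c * d)), - (q * b^2)] (q^2)
     - mthetas [b^4, - (q * c / (a * d)), a * c * d, - (a * c / d), q * a * c * d,
                - (q * a / (b^2 * c * d))] (q^2)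
     = mtheta (- (q * a * b^2 * c * d)) (q^2) * mtheta (- (b^2)) q
       / (mtheta (q * a^2) (q^2) * mtheta (- (sqrt q * a * b * c)) q)
       * (mthetas [b * c, - (b * c), a^2, sqrt q * b * d, - (sqrt q * b / (a * c)),
                   - (sqrt q * d / b)] q
          - mthetas [b^2, - (sqrt q * a), a * c * d, - (a * c / d), sqrt q * a,
                     - (sqrt q * a / (b * c))] q)"
proof -
  note q = assms(1,2) and nz = assms(3-6)
  define s where "s = complex_of_real (sqrt q)"
  have s: "s \<noteq> 0" "of_real q = s * s"
    using q by (auto simp: s_def simp flip: of_real_mult)
  have q2: "0 < q\<^sup>2" "q\<^sup>2 < 1"
    using q by (auto simp: power_less_one_iff)
  have sq: "mtheta w (q\<^sup>2) = mtheta z q * mtheta (- z) q" if "w = z\<^sup>2" "z \<noteq> 0" for w z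
    using mtheta_square[OF q that(2)] that(1) by simp
  have bis: "mtheta w q = mtheta w (q\<^sup>2) * mtheta z (q\<^sup>2)" if "z = of_real q * w" "w \<noteq> 0" for w z
    using mtheta_bisect[OF q that(2)] that(1) by simp

  have b4: "mtheta (b^4) (q\<^sup>2) = mtheta (b\<^sup>2) q * mtheta (- (b\<^sup>2)) q"
    using nz by (intro sq) (auto simp: power2_eq_square power4_eq_xxxx)
  have mb2: "mtheta (- (b\<^sup>2)) q = mtheta (- (b\<^sup>2)) (q\<^sup>2) * mtheta (- (q * b\<^sup>2)) (q\<^sup>2)"
    using nz by (intro bis) auto
  have qbd: "mtheta (q * b\<^sup>2 * d\<^sup>2) (q\<^sup>2) = mtheta (s * b * d) q * mtheta (- (s * b * d)) q"
    using nz s by (intro sq) (auto simp: power2_eq_square mult_ac)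
  have acd: "mtheta (a * c * d) q = mtheta (a * c * d) (q\<^sup>2) * mtheta (q * a * c * d) (q\<^sup>2)"
    using nz by (intro bis) (auto simp: mult_ac)
  have acd': "mtheta (- (a * c / d)) q = mtheta (- (a * c / d)) (q\<^sup>2) * mtheta (- (q * a * c / d)) (q\<^sup>2)"
    using nz by (intro bis) (auto simp: mult_ac)
  have bc: "mtheta (b\<^sup>2 * c\<^sup>2) (q\<^sup>2) = mtheta (b * c) q * mtheta (- (b * c)) q"
    using nz by (intro sq) (auto simp: power2_eq_square mult_ac)
  have aa: "mtheta (a\<^sup>2) q = mtheta (a\<^sup>2) (q\<^sup>2) * mtheta (q * a\<^sup>2) (q\<^sup>2)"
    using nz by (intro bis) auto
  have qaa: "mtheta (q * a\<^sup>2) (q\<^sup>2) = mtheta (s * a) q * mtheta (- (s * a)) q"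
    using nz s by (intro sq) (auto simp: power2_eq_square mult_ac)
  have db: "mtheta (- (s * d / b)) q = mtheta (- (s * b / d)) q"
    using mtheta_inversion[OF q(1), of "- (s * b / d)"] s nz by simp

  have B1: "mtheta (- (s * a * b * c)) q * mtheta (- (s * b * d)) q * mtheta (- (q * b\<^sup>2 / (a * c * d))) (q\<^sup>2)
      - mtheta (- (s * b / (a * c))) q * mtheta (- (s * b / d)) q * mtheta (- (q * a * b\<^sup>2 * c * d)) (q\<^sup>2)
      = s / (a * b * c) * (mtheta (b\<^sup>2) q * mtheta (a * c * d) q * mtheta (- (a * c / d)) (q\<^sup>2))"
  proof -
    have eqs: "a * c * - (s * b) = - (s * a * b * c)" "d * - (s * b) = - (s * b * d)"
      "- (s * b) / (a * c) = - (s * b / (a * c))" "- (s * b) / d = - (s * b / d)"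
      "(- (s * b))\<^sup>2 = of_real q * b\<^sup>2" "a * c * d * (of_real q * b\<^sup>2) = of_real q * a * b\<^sup>2 * c * d"
      using s by (simp_all add: power2_eq_square)
    have shift: "mtheta (of_real q * b\<^sup>2) q = - mtheta (b\<^sup>2) q / b\<^sup>2"
      using nz by (intro mtheta_shift q) auto
    have coeff: "- (s * b / (a * c)) * (- m / b\<^sup>2 * n * r) = s / (a * b * c) * (m * n * r)" for m n r
      using nz by (simp add: field_simps power2_eq_square)
    show ?thesis
      using mtheta_two_base_reflection[OF q, of "- (s * b)" "a * c" d] nz s(1)
      unfolding eqs shift coeff by simp
  qed
  have B2: "mtheta (- (s * a * b * c)) q * (mtheta (- (q * c / (a * d))) (q\<^sup>2) * mtheta (- (q * a / (b\<^sup>2 * c * d))) (q\<^sup>2))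
      - mtheta (- (s * a / (b * c))) q * (mtheta (- (q * a * b\<^sup>2 * c * d)) (q\<^sup>2) * mtheta (- (q * a * c / d)) (q\<^sup>2))
      = s / (a * b * c) * (mtheta (s * b * d) q * (mtheta (a\<^sup>2) (q\<^sup>2) * mtheta (b\<^sup>2 * c\<^sup>2) (q\<^sup>2)))"
  proof -
    have eqs: "- (s * a / (b * c)) * (s * b * d) = - (of_real q * a * d / c)"
      "of_real q * - (s * a / (b * c)) / (s * b * d) = - (of_real q * a / (b\<^sup>2 * c * d))"
      "- (s * a * b * c) * (s * b * d) = - (of_real q * a * b\<^sup>2 * c * d)"
      "of_real q * - (s * a * b * c) / (s * b * d) = - (of_real q * a * c / d)"
      "of_real q * - (s * a * b * c) * - (s * a / (b * c)) = of_real (q\<^sup>2) * a\<^sup>2"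
      "- (s * a * b * c) / - (s * a / (b * c)) = b\<^sup>2 * c\<^sup>2"
      using s nz by (simp_all add: power2_eq_square field_simps)
    have 1: "mtheta (of_real (q\<^sup>2) * a\<^sup>2) (q\<^sup>2) = - mtheta (a\<^sup>2) (q\<^sup>2) / a\<^sup>2"
      using nz by (intro mtheta_shift q2) auto
    have 2: "mtheta (- (of_real q * a * d / c)) (q\<^sup>2) = mtheta (- (q * c / (a * d))) (q\<^sup>2)"
      using mtheta_inversion[OF q2(1), of "- (of_real q * a * d / c)"] nz q
      by (simp add: power2_eq_square mult_ac)
    show ?thesis
      using mtheta_two_base_addition[OF q, of "- (s * a * b * c)" "- (s * a / (b * c))" "s * b * d"] nz s(1)
      unfolding eqs 1 2 by (simp add: power2_eq_square mult_ac)
  qed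

  define K L where "K = mtheta (- (s * a * b * c)) q" and "L = mtheta (- (q * a * b\<^sup>2 * c * d)) (q\<^sup>2)"
  have K: "K \<noteq> 0" and Q: "mtheta (q * a\<^sup>2) (q\<^sup>2) \<noteq> 0"
    using assms(7,8) by (simp_all add: K_def s_def)
  define X where "X = mtheta (a\<^sup>2) (q\<^sup>2) * mtheta (b\<^sup>2 * c\<^sup>2) (q\<^sup>2) * mtheta (s * b * d) q
      * mtheta (- (s * b * d)) q * mtheta (- (q * b\<^sup>2 / (a * c * d))) (q\<^sup>2)
    - mtheta (b\<^sup>2) q * mtheta (a * c * d) q * mtheta (- (a * c / d)) (q\<^sup>2)
      * mtheta (- (q * c / (a * d))) (q\<^sup>2) * mtheta (- (q * a / (b\<^sup>2 * c * d))) (q\<^sup>2)"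
  define Y where "Y = mtheta (a\<^sup>2) (q\<^sup>2) * mtheta (b\<^sup>2 * c\<^sup>2) (q\<^sup>2) * mtheta (s * b * d) q
      * mtheta (- (s * b / (a * c))) q * mtheta (- (s * b / d)) q
    - mtheta (b\<^sup>2) q * mtheta (a * c * d) q * mtheta (- (a * c / d)) (q\<^sup>2)
      * mtheta (- (q * a * c / d)) (q\<^sup>2) * mtheta (- (s * a / (b * c))) q"
  have XY: "K * X = L * Y"
  proof -
    define U V where "U = mtheta (a\<^sup>2) (q\<^sup>2) * mtheta (b\<^sup>2 * c\<^sup>2) (q\<^sup>2) * mtheta (s * b * d) q"
      and "V = mtheta (b\<^sup>2) q * mtheta (a * c * d) q * mtheta (- (a * c / d)) (q\<^sup>2)"
    have "K * X - L * Y
       = U * (K * mtheta (- (s * b * d)) q * mtheta (- (q * b\<^sup>2 / (a * c * d))) (q\<^sup>2)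
            - mtheta (- (s * b / (a * c))) q * mtheta (- (s * b / d)) q * L)
       - V * (K * (mtheta (- (q * c / (a * d))) (q\<^sup>2) * mtheta (- (q * a / (b\<^sup>2 * c * d))) (q\<^sup>2))
            - mtheta (- (s * a / (b * c))) q * (L * mtheta (- (q * a * c / d)) (q\<^sup>2)))"
      unfolding X_def Y_def U_def V_def by (simp add: algebra_simps)
    also have "\<dots> = 0"
      unfolding K_def L_def B1 B2 unfolding U_def V_def by (simp add: mult_ac)
    finally show ?thesis by simp
  qed

  have "mthetas [a^2, b^2 * c^2, - (b^2), q * b^2 * d^2, - (q * b^2 / (a * c * d)), - (q * b^2)] (q^2)
     - mthetas [b^4, - (q * c / (a * d)), a * c * d, - (a * c / d), q * a * c * d,
                - (q * a / (b^2 * c * d))] (q^2) = mtheta (- (b\<^sup>2)) q * X"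
    unfolding X_def mthetas_def list.map prod_list.Cons qbd acd b4 mb2
    by (simp add: algebra_simps)
  moreover have "mthetas [b * c, - (b * c), a^2, s * b * d, - (s * b / (a * c)), - (s * d / b)] q
     - mthetas [b^2, - (s * a), a * c * d, - (a * c / d), s * a, - (s * a / (b * c))] q
     = mtheta (q * a\<^sup>2) (q\<^sup>2) * Y"
    unfolding Y_def mthetas_def list.map prod_list.Cons aa db acd' bc qaa
    by (simp add: algebra_simps)
  moreover have "mtheta (- (b\<^sup>2)) q * X = L * mtheta (- (b\<^sup>2)) q / (mtheta (q * a\<^sup>2) (q\<^sup>2) * K)
      * (mtheta (q * a\<^sup>2) (q\<^sup>2) * Y)"
    using K Q XY by (simp add: field_simps)
  ultimately show ?thesis
    unfolding s_def [symmetric] K_def [symmetric] L_def [symmetric] by simp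
qed

end
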